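(* There are infinitely many four-square polynomial triples $\{a,b,c\}$ in $\mathbb{R}[X]$ with all three entries $a,b,c$ nonconstant.
   Context: A set $\{a,b,c\}\subset\mathbb{R}[X]$ of three (hence pairwise distinct) nonzero polynomials is called a four-square polynomial triple if there exist $r,s,t,u\in\mathbb{R}[X]$ such that $ab+1=r^2$, $ac+1=s^2$, $bc+1=t^2$, $abc+1=u^2$. *)

theory Defs
  imports Complex_Main "HOL-Computational_Algebra.Polynomial"
begin

definition four_square_polynomial_triple :: "real poly set \<Rightarrow> bool" where
  "four_square_polynomial_triple T \<longleftrightarrow>
     (\<exists>a b c. T = {a, b, c} \<and> a \<noteq> b \<and> a \<noteq> c \<and> b \<noteq> c \<and>
        a \<noteq> 0 \<and> b \<noteq> 0 \<and> c \<noteq> 0 \<and>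
        (\<exists>r s t u. a * b + 1 = r ^ 2 \<and> a * c + 1 = s ^ 2 \<and>
           b * c + 1 = t ^ 2 \<and> a * b * c + 1 = u ^ 2))"

end

theory Submission
  imports Defs
begin

text \<open>
  If \<open>k l = 1\<close>, then \<open>a = k (y - 1)\<close> and \<open>b = l (y + 1)\<close> satisfy \<open>a b + 1 = y\<^sup>2\<close>, and
  \<open>c = a + b + 2 y\<close> completes them to a triple for which \<open>a c + 1\<close> and \<open>b c + 1\<close> are the squares of
  \<open>a + y\<close> and \<open>b + y\<close>. The remaining expression \<open>a b c + 1\<close> is a cubic in \<open>y\<close>. For a suitable real
  \<open>k\<close> it has a double root \<open>\<rho>\<close>, so it equals \<open>\<alpha> (y - \<rho>)\<^sup>2 (y - \<sigma>)\<close>, and it becomes a square upon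
  setting \<open>y = \<sigma> + \<alpha> p\<^sup>2\<close> with an arbitrary polynomial \<open>p\<close>. Vanishing of the discriminant
  amounts to \<open>8 \<rho>\<^sup>3 + 9 \<rho>\<^sup>2 - 8 \<rho> - 1 = 0\<close>.
\<close>

text \<open>The second and third assumptions make \<open>c\<close> equal to
  \<open>a + b + 2 * y\<close>. The next three are Vieta's relations for roots \<rho>, \<rho>,
  \<sigma> of \<open>a * b * c + 1\<close> as a cubic in \<open>y\<close>. Working over any integral
  domain allows the parameters to be constant polynomials.\<close>

lemma four_squares_of_double_root:
  fixes k l \<alpha> \<mu> \<rho> \<sigma> p y a b c :: "'a :: idom"
  assumes "k * l = 1" "k + l + 2 = \<alpha>" "l - k = \<alpha> * \<mu>"
    and "\<mu> = - 2 * \<rho> - \<sigma>" "\<rho>^2 + 2 * \<rho> * \<sigma> = - 1" "\<alpha> * (\<mu> - \<rho>^2 * \<sigma>) = 1"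
    and "y = \<sigma> + \<alpha> * p^2"
    and "a = k * (y - 1)" "b = l * (y + 1)" "c = \<alpha> * (y + \<mu>)"
  shows "a * b + 1 = y^2" "a * c + 1 = (a + y)^2" "b * c + 1 = (b + y)^2"
    "a * b * c + 1 = (\<alpha> * p * (y - \<rho>))^2"
proof -
  show ab: "a * b + 1 = y^2"
    using assms(1,8,9) by algebra
  have "a + b + 2 * y = (k + l + 2) * y + (l - k)"
    using assms(8,9) by (simp add: algebra_simps)
  then have c: "c = a + b + 2 * y"
    using assms(10) by (simp only: assms(2,3) distrib_left)
  show "a * c + 1 = (a + y)^2" "b * c + 1 = (b + y)^2"
    using ab c by algebra+
  have "a * b * c + 1 = (y^2 - 1) * (\<alpha> * (y + \<mu>)) + 1"
    using ab assms(10) by algebra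
  also have "\<dots> = \<alpha> * (y - \<rho>)^2 * (y - \<sigma>)"
  proof -
    have "(y - \<rho>)^2 * (y - \<sigma>) = y^3 + (- 2 * \<rho> - \<sigma>) * y^2 + (\<rho>^2 + 2 * \<rho> * \<sigma>) * y - \<rho>^2 * \<sigma>"
      by algebra
    also have "\<dots> = y^3 + \<mu> * y^2 + - 1 * y - \<rho>^2 * \<sigma>"
      by (simp only: assms(4,5))
    finally show ?thesis
      using assms(6) by algebra
  qed
  also have "\<dots> = (\<alpha> * p * (y - \<rho>))^2"
    using assms(7) by algebra
  finally show "a * b * c + 1 = (\<alpha> * p * (y - \<rho>))^2" .
qed

lemma double_root_parameters:
  obtains k l \<alpha> \<mu> \<rho> \<sigma> :: real
  where "k * l = 1" "k + l + 2 = \<alpha>" "l - k = \<alpha> * \<mu>"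
    "\<mu> = - 2 * \<rho> - \<sigma>" "\<rho>^2 + 2 * \<rho> * \<sigma> = - 1" "\<alpha> * (\<mu> - \<rho>^2 * \<sigma>) = 1"
    "\<mu> \<noteq> 1" "\<mu> \<noteq> - 1" "\<alpha> \<noteq> 0"
proof -
  \<comment> \<open>The cubic is negative at 1/2 and positive at 1. The lower bound keeps \<rho>
    away from 0 and 1/3, which later gives \<mu> \<noteq> 1.\<close>
  have "\<exists>\<rho>\<ge>1/2. \<rho> \<le> 1 \<and> 8 * \<rho>^3 + 9 * \<rho>^2 - 8 * \<rho> - 1 = (0::real)"
    by (rule IVT') (auto simp: power2_eq_square power3_eq_cube intro!: continuous_intros)
  then obtain \<rho> :: real where \<rho>: "1/2 \<le> \<rho>" "\<rho> \<le> 1" "8 * \<rho>^3 + 9 * \<rho>^2 - 8 * \<rho> - 1 = 0"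
    by blast
  have "\<rho> \<noteq> 1"
    using \<rho>(3) by auto
  \<comment> \<open>With \<rho> given, two of Vieta's relations are linear in \<sigma> and \<mu>;
    these are their solutions.\<close>
  define \<mu> where "\<mu> = (1 - 3 * \<rho>^2) / (2 * \<rho>)"
  define \<sigma> where "\<sigma> = - (1 + \<rho>^2) / (2 * \<rho>)"
  have \<mu>\<rho>: "2 * \<rho> * \<mu> = 1 - 3 * \<rho>^2" and \<sigma>\<rho>: "2 * \<rho> * \<sigma> = - 1 - \<rho>^2"
    using \<rho>(1) by (auto simp: \<mu>_def \<sigma>_def field_simps)
  have "2 * \<rho> * (1 - \<mu>) = (3 * \<rho> - 1) * (\<rho> + 1)" "2 * \<rho> * (1 + \<mu>) = (1 - \<rho>) * (3 * \<rho> + 1)"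
    using \<mu>\<rho> by algebra+
  moreover have "(3 * \<rho> - 1) * (\<rho> + 1) \<noteq> 0" "(1 - \<rho>) * (3 * \<rho> + 1) \<noteq> 0"
    using \<rho>(1) \<open>\<rho> \<noteq> 1\<close> by auto
  ultimately have nz: "1 - \<mu> \<noteq> 0" "1 + \<mu> \<noteq> 0"
    by auto
  have "2 * \<rho> * (\<mu> + 2 * \<rho> + \<sigma>) = 0"
    using \<mu>\<rho> \<sigma>\<rho> by algebra
  then have \<mu>: "\<mu> = - 2 * \<rho> - \<sigma>"
    using \<rho>(1) by auto
  \<comment> \<open>The last Vieta relation, for \<alpha> = 4 / ((1 - \<mu>) * (1 + \<mu>)), reduces
    to the cubic equation for \<rho>.\<close>
  have "4 * \<rho>^2 * (4 * (\<mu> - \<rho>^2 * \<sigma>) - (1 - \<mu>) * (1 + \<mu>)) =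
      (1 - \<rho>^2) * - (8 * \<rho>^3 + 9 * \<rho>^2 - 8 * \<rho> - 1)"
    using \<mu>\<rho> \<sigma>\<rho> by algebra
  then have disc: "4 * (\<mu> - \<rho>^2 * \<sigma>) = (1 - \<mu>) * (1 + \<mu>)"
    using \<rho> by auto
  show thesis
  proof (rule that)
    \<comment> \<open>Eliminating \<open>l\<close> and \<alpha> from the first three equations gives
      \<mu> = (1 - k) / (1 + k), which is solved for \<open>k\<close> here.\<close>
    show "(1 - \<mu>) / (1 + \<mu>) * ((1 + \<mu>) / (1 - \<mu>)) = 1"
      using nz by simp
    show "(1 - \<mu>) / (1 + \<mu>) + (1 + \<mu>) / (1 - \<mu>) + 2 = 4 / ((1 - \<mu>) * (1 + \<mu>))"
      using nz by (simp add: divide_simps) (simp add: algebra_simps)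
    show "(1 + \<mu>) / (1 - \<mu>) - (1 - \<mu>) / (1 + \<mu>) = 4 / ((1 - \<mu>) * (1 + \<mu>)) * \<mu>"
      using nz by (simp add: divide_simps) (simp add: algebra_simps)
    show "4 / ((1 - \<mu>) * (1 + \<mu>)) * (\<mu> - \<rho>^2 * \<sigma>) = 1"
      using nz disc by simp
  qed (use nz \<mu> \<sigma>\<rho> in auto)
qed

theorem corollary4p2:
  shows "infinite {T. four_square_polynomial_triple T \<and> (\<forall>p\<in>T. degree p \<noteq> 0)}"
proof -
  obtain k l \<alpha> \<mu> \<rho> \<sigma> :: real where
    eqs: "k * l = 1" "k + l + 2 = \<alpha>" "l - k = \<alpha> * \<mu>"
      "\<mu> = - 2 * \<rho> - \<sigma>" "\<rho>^2 + 2 * \<rho> * \<sigma> = - 1" "\<alpha> * (\<mu> - \<rho>^2 * \<sigma>) = 1"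
    and nz: "\<mu> \<noteq> 1" "\<mu> \<noteq> - 1" "\<alpha> \<noteq> 0"
    by (rule double_root_parameters)
  \<comment> \<open>The exponent \<open>Suc n\<close> makes \<open>p n\<close> nonconstant even for
    \<open>n = 0\<close>.\<close>
  define p :: "nat \<Rightarrow> real poly" where "p n = monom 1 (Suc n)" for n
  define y where "y n = [:\<sigma>:] + [:\<alpha>:] * p n ^ 2" for n
  define a where "a n = [:k:] * (y n - 1)" for n
  define b where "b n = [:l:] * (y n + 1)" for n
  define c where "c n = [:\<alpha>:] * (y n + [:\<mu>:])" for n
  define T where "T n = {a n, b n, c n}" for n
  have kl: "k \<noteq> 0" "l \<noteq> 0"
    using eqs(1) by auto
  have y_shift: "degree (y n + [:d:]) = 2 * Suc n" for n d
  proof -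
    have "y n + [:d:] = monom \<alpha> (2 * Suc n) + [:\<sigma> + d:]"
      by (simp add: y_def p_def power2_eq_square mult_monom smult_monom mult_2)
    then show ?thesis
      using nz(3) by (simp add: degree_add_eq_left degree_monom_eq)
  qed
  have a_eq: "a n = [:k:] * (y n + [:- 1:])" and b_eq: "b n = [:l:] * (y n + [:1:])" for n
    unfolding a_def b_def diff_conv_add_uminus by (simp_all add: one_pCons)
  have deg: "degree (a n) = 2 * Suc n" "degree (b n) = 2 * Suc n" "degree (c n) = 2 * Suc n" for n
    using y_shift kl nz(3) by (simp_all add: a_eq b_eq c_def)
  have ne: "a n \<noteq> b n" "a n \<noteq> c n" "b n \<noteq> c n" for n
  proof -
    \<comment> \<open>If \<open>u\<close> and \<open>v\<close> differed, the difference of the two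
      sides would be a nonzero multiple of \<open>y n\<close> plus a constant, which has positive
      degree. Hence the distinct shifts -1, 1 and \<mu> separate the three entries.\<close>
    have affine: "u = v \<and> s = t" if "[:u:] * (y n + [:s:]) = [:v:] * (y n + [:t:])" "u \<noteq> 0"
      for u v s t
    proof -
      have "u = v"
      proof (rule ccontr)
        assume "u \<noteq> v"
        have "[:u - v:] * (y n + [:(u * s - v * t) / (u - v):]) =
            [:u:] * (y n + [:s:]) - [:v:] * (y n + [:t:])"
          using \<open>u \<noteq> v\<close> by (simp add: smult_add_right smult_diff_left)
        also have "\<dots> = 0"
          using that by simp
        finally have "y n + [:(u * s - v * t) / (u - v):] = 0"
          using \<open>u \<noteq> v\<close> by simp
        with y_shift[of n "(u * s - v * t) / (u - v)"] show False
          by simp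
      qed
      with that have "y n + [:s:] = y n + [:t:]"
        by (metis mult_left_cancel pCons_eq_0_iff)
      with \<open>u = v\<close> show ?thesis
        by simp
    qed
    show "a n \<noteq> b n" "a n \<noteq> c n" "b n \<noteq> c n"
      using affine[of k "- 1" l 1] affine[of k "- 1" \<alpha> \<mu>] affine[of l 1 \<alpha> \<mu>] kl nz
      by (auto simp: a_eq b_eq c_def simp del: mult_pCons_left)
  qed
  have sq: "a n * b n + 1 = y n ^ 2" "a n * c n + 1 = (a n + y n) ^ 2"
    "b n * c n + 1 = (b n + y n) ^ 2" "a n * b n * c n + 1 = ([:\<alpha>:] * p n * (y n - [:\<rho>:])) ^ 2" for n
  proof -
    have num: "2 = [:2::real:]" "- 1 = [:- 1::real:]" "1 = [:1::real:]"
      by (simp_all add: numeral_poly flip: pCons_one)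
    have lifted: "[:k:] * [:l:] = 1" "[:k:] + [:l:] + 2 = [:\<alpha>:]" "[:l:] - [:k:] = [:\<alpha>:] * [:\<mu>:]"
      "[:\<mu>:] = - 2 * [:\<rho>:] - [:\<sigma>:]" "[:\<rho>:]^2 + 2 * [:\<rho>:] * [:\<sigma>:] = - 1"
      "[:\<alpha>:] * ([:\<mu>:] - [:\<rho>:]^2 * [:\<sigma>:]) = 1"
      using eqs by (simp_all add: num power2_eq_square ac_simps)
    note squares = four_squares_of_double_root[OF lifted y_def a_def b_def c_def]
    show "a n * b n + 1 = y n ^ 2" "a n * c n + 1 = (a n + y n) ^ 2"
      "b n * c n + 1 = (b n + y n) ^ 2" "a n * b n * c n + 1 = ([:\<alpha>:] * p n * (y n - [:\<rho>:])) ^ 2"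
      by (rule squares)+
  qed
  have "four_square_polynomial_triple (T n)" for n
  proof -
    have "a n \<noteq> 0" "b n \<noteq> 0" "c n \<noteq> 0"
      using deg[of n] by auto
    then show ?thesis
      unfolding four_square_polynomial_triple_def T_def using ne[of n] sq[of n] by blast
  qed
  then have "range T \<subseteq> {T. four_square_polynomial_triple T \<and> (\<forall>p\<in>T. degree p \<noteq> 0)}"
    using deg by (auto simp: T_def)
  moreover have "inj T"
  proof (rule injI)
    fix m n assume "T m = T n"
    \<comment> \<open>All three entries share one degree, so the unordered set \<open>T i\<close>
      determines \<open>i\<close>.\<close>
    moreover have "degree ` T i = {2 * Suc i}" for i
      using deg by (simp add: T_def)
    ultimately have "{2 * Suc m} = {2 * Suc n}"
      by metis
    then show "m = n"
      by simp
  qed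
  ultimately show ?thesis
    using range_inj_infinite infinite_super by blast
qed

end
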